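(* Let $G$ be either the De Bruijn digraph $B(d,D)$ or the Kautz digraph $K(d,D)$, with vertex set $V$. Let $v=v_1\cdots v_D\in V$, $w=w_1\cdots w_D\in S_1(v)$, and let $1\le i\le D$. Assume that $S_{i}^\star(v) \cap S_{i-1}^{\star}(w)\ne\emptyset$ and that $S_{i}^\star(v) \cap S_{j_0}^{\star}(w)\ne\emptyset$ for some $i\le j_0\le D$. Then $$S_i^\star(v)=\left(S_{i}^\star(v) \cap S_{i-1}^{\star}(w)\right)\cup \left(S_{i}^\star(v) \cap S_{j_0}^{\star}(w)\right),$$ and so $$|S_i^\star(v)|=|S_{i}^\star(v) \cap S_{i-1}^{\star}(w)|+ |S_{i}^\star(v) \cap S_{j_0}^{\star}(w)|.$$ Moreover, if $$|S_{i}^\star(v)|=d^i-a_{i-1}d^{i-1}-\cdots -a_{1} d-a_{0}$$ is the polynomial expression of $|S_i^\star(v)|$ in which $a_k\in\{0,1\}$ and $a_k=1$ if and only if $S_{k,i}(v)\ne\emptyset$ ($0\le k\le i-1$), then $$|S_{i}^\star(v) \cap S_{i-1}^{\star}(w)| = d^{i-1}-b_{i-2}d^{i-2}-\cdots -b_{1} d-b_{0},$$ $$|S_{i}^\star(v) \cap S_{j_0}^{\star}(w)| = d^i-(a_{i-1}+1)d^{i-1}-(a_{i-2}-b_{i-2})d^{i-2} -\cdots -(a_1-b_{1}) d-(a_0-b_{0}),$$ where, for $0\le k\le i-2$, $b_k\in\{0,1\}$ and $b_k=1$ if and only if $a_k=1$ and $v_{D-i+k+1}=w_D$.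
   Context: Let $d\ge 2$ and $D\ge 1$ be integers. The De Bruijn digraph $B(d,D)$ has as vertices all words $v=v_1v_2\cdots v_D$ over an alphabet $A$ with $|A|=d$; $v$ is adjacent to the $d$ vertices $v_2\cdots v_D v_{D+1}$, $v_{D+1}\in A$ (loops occur). The Kautz digraph $K(d,D)$ has as vertices all words $v=v_1v_2\cdots v_D$ over an alphabet $A$ with $|A|=d+1$ such that $v_k\ne v_{k+1}$ for $1\le k<D$; $v$ is adjacent to the $d$ vertices $v_2\cdots v_Dv_{D+1}$ with $v_{D+1}\in A$, $v_{D+1}\ne v_D$. Both are $d$-regular of diameter $D$. For $v\in V$ and $i\ge 0$, $S_i(v)$ is the set of vertices $u$ for which there is a walk of length exactly $i$ from $v$ to $u$ (so $S_1(v)$ is the set of vertices adjacent from $v$), and $S_i^\star(v)$ is the set of vertices at (directed) distance exactly $i$ from $v$. For integers $0\le k\le i\le D$: $S_{k,i}(v)=S_k(v)$ if $S_k(v)\subseteq S_i(v)$ and, for all $j$ with $k<j<i$ such that $S_j(v)\subseteq S_i(v)$, we have $S_k(v)\not\subseteq S_j(v)$; otherwise $S_{k,i}(v)=\emptyset$. *)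

theory Defs
  imports "Graph_Theory.Shortest_Path"
begin

definition de_bruijn :: "'a set \<Rightarrow> nat \<Rightarrow> ('a list, 'a list \<times> 'a list) pre_digraph" where
  "de_bruijn A D =
    \<lparr> verts = {v. set v \<subseteq> A \<and> length v = D},
      arcs = {(v, tl v @ [x]) | v x. set v \<subseteq> A \<and> length v = D \<and> x \<in> A},
      tail = fst, head = snd \<rparr>"

definition kautz :: "'a set \<Rightarrow> nat \<Rightarrow> ('a list, 'a list \<times> 'a list) pre_digraph" where
  "kautz A D =
    \<lparr> verts = {v. set v \<subseteq> A \<and> length v = D \<and> (\<forall>k. Suc k < D \<longrightarrow> v ! k \<noteq> v ! Suc k)},
      arcs = {(v, tl v @ [x]) | v x. set v \<subseteq> A \<and> length v = D \<and>
                (\<forall>k. Suc k < D \<longrightarrow> v ! k \<noteq> v ! Suc k) \<and> x \<in> A \<and> x \<noteq> last v},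
      tail = fst, head = snd \<rparr>"

(* walk_sphere G i v is S_i(v), dist_sphere G i v is S_i^*(v), and
   max_walk_sphere G k i v is S_{k,i}(v). *)

definition walk_sphere :: "('a, 'b) pre_digraph \<Rightarrow> nat \<Rightarrow> 'a \<Rightarrow> 'a set" where
  "walk_sphere G i v = {u. \<exists>p. pre_digraph.awalk G v p u \<and> length p = i}"

(* Directed distance is the shortest-path distance for unit arc weights;
   it is infinite for unreachable vertices. *)
definition dist_sphere :: "('a, 'b) pre_digraph \<Rightarrow> nat \<Rightarrow> 'a \<Rightarrow> 'a set" where
  "dist_sphere G i v = {u \<in> verts G. wf_digraph.\<mu> G (\<lambda>_. 1) v u = ereal (real i)}"

definition max_walk_sphere :: "('a, 'b) pre_digraph \<Rightarrow> nat \<Rightarrow> nat \<Rightarrow> 'a \<Rightarrow> 'a set" where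
  "max_walk_sphere G k i v =
    (if walk_sphere G k v \<subseteq> walk_sphere G i v \<and>
        (\<forall>j. k < j \<and> j < i \<and> walk_sphere G j v \<subseteq> walk_sphere G i v
              \<longrightarrow> \<not> walk_sphere G k v \<subseteq> walk_sphere G j v)
     then walk_sphere G k v else {})"

(* The library unfolds \<mu> only for well-formed digraphs. *)

lemma wf_digraph_de_bruijn:
  assumes "D \<ge> 1"
  shows "wf_digraph (de_bruijn A D)"
proof
  fix e assume "e \<in> arcs (de_bruijn A D)"
  then obtain v x where e: "e = (v, tl v @ [x])" "set v \<subseteq> A" "length v = D" "x \<in> A"
    by (auto simp: de_bruijn_def)
  then show "tail (de_bruijn A D) e \<in> verts (de_bruijn A D)"
    by (simp add: de_bruijn_def)
  have "set (tl v) \<subseteq> A" using e(2) by (cases v) auto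
  then show "head (de_bruijn A D) e \<in> verts (de_bruijn A D)"
    using e assms by (simp add: de_bruijn_def)
qed

lemma wf_digraph_kautz:
  assumes "D \<ge> 1"
  shows "wf_digraph (kautz A D)"
proof
  fix e assume "e \<in> arcs (kautz A D)"
  then obtain v x where e: "e = (v, tl v @ [x])" "set v \<subseteq> A" "length v = D" "x \<in> A"
      "\<And>k. Suc k < D \<Longrightarrow> v ! k \<noteq> v ! Suc k" "x \<noteq> last v"
    by (auto simp: kautz_def)
  then show "tail (kautz A D) e \<in> verts (kautz A D)"
    by (simp add: kautz_def)
  have sub: "set (tl v) \<subseteq> A" using e(2) by (cases v) auto
  have "(tl v @ [x]) ! k \<noteq> (tl v @ [x]) ! Suc k" if k: "Suc k < D" for k
  proof (cases "Suc (Suc k) < D")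
    case True
    then have "Suc k < D - 1" by simp
    with True show ?thesis using e by (simp add: nth_append nth_tl)
  next
    case False
    then have D: "D = Suc (Suc k)" using k by simp
    have "last v = v ! Suc k" using D e(3) by (subst last_conv_nth) auto
    then show ?thesis using D e(3,6) by (simp add: nth_append nth_tl)
  qed
  then show "head (kautz A D) e \<in> verts (kautz A D)"
    using e assms sub by (simp add: kautz_def)
qed

end

theory Submission
  imports Defs
begin

text \<open>
  Both families are shift digraphs on words in which a relation \<open>R\<close> restricts consecutive letters:
  \<open>R\<close> is always true for De Bruijn digraphs and is \<open>\<noteq>\<close> for Kautz digraphs. The proof uses two
  properties of \<open>R\<close> only: every letter has exactly \<open>d\<close> possible successors, and a letter can be
  followed by every letter different from it.

  For \<open>k \<le> D\<close> a walk of length \<open>k\<close> from \<open>v\<close> deletes the first \<open>k\<close> letters of \<open>v\<close> and appends \<open>k\<close>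
  others, so \<open>S\<^sub>k(v)\<close> has \<open>d\<^sup>k\<close> elements and consists of the words that start with
  \<open>v\<^sub>k\<^sub>+\<^sub>1 \<dots> v\<^sub>D\<close> (for \<open>k = D\<close>, of those whose first letter may follow \<open>v\<^sub>D\<close>). Sets given by
  prefixes are laminar: a sphere with a longer prefix lies inside a sphere with a shorter
  prefix or is disjoint from it (\<open>walk_sphere_laminar\<close>). This also compares spheres around
  different centres.

  Consider first the part near to \<open>w\<close>. A vertex of \<open>S\<^sub>i\<^sub>-\<^sub>1(w)\<close> that is at distance \<open>i\<close> from \<open>v\<close> cannot be closer than \<open>i - 1\<close> to
  the out-neighbour \<open>w\<close>, so this part is \<open>S\<^sub>i\<^sub>-\<^sub>1(w)\<close> without the smaller spheres around \<open>v\<close>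
  (\<open>dist_sphere_inter_neighbour\<close>). By laminarity it suffices to remove the disjoint spheres
  \<open>S\<^sub>k\<^sub>,\<^sub>i(v)\<close> that lie in \<open>S\<^sub>i\<^sub>-\<^sub>1(w)\<close>. Inside \<open>S\<^sub>i(v)\<close> membership in \<open>S\<^sub>i\<^sub>-\<^sub>1(w)\<close> only depends on the letter
  that comes after the prefix \<open>v\<^sub>i\<^sub>+\<^sub>1 \<dots> v\<^sub>D\<close>, and on \<open>S\<^sub>k(v)\<close> this letter is constant; comparing it
  with \<open>w\<^sub>D\<close> gives the condition for \<open>b\<^sub>k = 1\<close> (\<open>card_dist_sphere_inter_neighbour\<close>).

  The other vertices at distance \<open>i\<close> from \<open>v\<close> have distance at least \<open>i\<close> from \<open>w\<close>.
  By laminarity a sphere \<open>S\<^sub>m(w)\<close> with \<open>m \<ge> i\<close> contains all of \<open>S\<^sub>i(v)\<close> or nothing of it when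
  \<open>i < D\<close>. When \<open>i = D\<close> only \<open>m = D\<close> remains, and \<open>S\<^sub>D(w)\<close> contains all these vertices, because
  they do not start with \<open>w\<^sub>D\<close>. So they have the same distance from \<open>w\<close>; a single one at distance
  \<open>j\<^sub>0\<close> forces the distance \<open>j\<^sub>0\<close> on all of them (\<open>dist_sphere_diff_neighbour\<close>). The last
  count is then the difference of the other two.
\<close>

section \<open>Walk spheres and distance spheres\<close>

context wf_digraph
begin

lemma walk_sphere_subset_verts: "walk_sphere G k v \<subseteq> verts G"
  by (auto simp: walk_sphere_def dest: awalk_last_in_verts)

lemma walk_sphere_0: "v \<in> verts G \<Longrightarrow> walk_sphere G 0 v = {v}"
  by (auto simp: walk_sphere_def awalk_Nil_iff)

lemma walk_sphere_1: "walk_sphere G 1 v = head G ` {e \<in> arcs G. tail G e = v}"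
proof -
  have "u \<in> walk_sphere G 1 v \<longleftrightarrow> (\<exists>e. awalk v [e] u)" for u
    by (auto simp: walk_sphere_def length_Suc_conv)
  then show ?thesis
    by (auto simp: awalk_simps intro: head_in_verts)
qed

lemma walk_sphere_trans:
  assumes "u \<in> walk_sphere G k v" "x \<in> walk_sphere G m u"
  shows "x \<in> walk_sphere G (k + m) v"
proof -
  obtain p q where "awalk v p u" "length p = k" "awalk u q x" "length q = m"
    using assms by (auto simp: walk_sphere_def)
  then have "awalk v (p @ q) x" "length (p @ q) = k + m"
    by (auto intro: awalk_appendI)
  then show ?thesis unfolding walk_sphere_def by blast
qed

lemma walk_sphere_Suc: "walk_sphere G (Suc k) v = (\<Union>u\<in>walk_sphere G k v. walk_sphere G 1 u)"
proof (intro set_eqI iffI)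
  fix x assume "x \<in> walk_sphere G (Suc k) v"
  then obtain p where "awalk v p x" "length p = Suc k" by (auto simp: walk_sphere_def)
  moreover then obtain q e where "p = q @ [e]" "length q = k"
    by (metis length_append_singleton length_Suc_conv_rev nat.inject)
  ultimately have "awalk v q (awlast v q)" "awalk (awlast v q) [e] x" "length q = k" by auto
  then have "awlast v q \<in> walk_sphere G k v" "x \<in> walk_sphere G 1 (awlast v q)"
    unfolding walk_sphere_def
    by (blast, metis (mono_tags) One_nat_def length_Cons list.size(3) mem_Collect_eq)
  then show "x \<in> (\<Union>u\<in>walk_sphere G k v. walk_sphere G 1 u)" by blast
next
  fix x assume "x \<in> (\<Union>u\<in>walk_sphere G k v. walk_sphere G 1 u)"
  then show "x \<in> walk_sphere G (Suc k) v" using walk_sphere_trans[of _ k v x 1] by auto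
qed

text \<open>
  With unit weights the cost of a walk is its length. The lengths are natural numbers, so the
  infimum that defines the distance is attained: distance \<open>i\<close> means that there is a walk of
  length \<open>i\<close> and none that is shorter.
\<close>

lemma dist_sphere_eq: "dist_sphere G i v = walk_sphere G i v - (\<Union>k<i. walk_sphere G k v)"
proof (intro set_eqI iffI)
  have cost: "awalk_cost (\<lambda>_. 1) p = real (length p)" for p :: "'b list"
    by (simp add: awalk_cost_def sum_list_triv)
  fix u
  {
    assume u: "u \<in> dist_sphere G i v"
    then have mu: "\<mu> (\<lambda>_. 1) v u = ereal (real i)" by (simp add: dist_sphere_def)
    have long: "i \<le> length p" if "awalk v p u" for p
      using min_cost_le_walk_cost[OF that, of "\<lambda>_. 1"] by (simp add: mu cost)
    have "\<exists>p. awalk v p u \<and> length p = i"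
    proof (rule ccontr)
      assume "\<not> ?thesis"
      then have "Suc i \<le> length p" if "awalk v p u" for p
        using long[OF that] that by (metis Suc_leI le_neq_implies_less)
      then have "real (Suc i) \<le> real (length p)" if "awalk v p u" for p
        using that of_nat_mono by blast
      then have "ereal (real (Suc i)) \<le> \<mu> (\<lambda>_. 1) v u"
        unfolding \<mu>_def cost by (intro INF_greatest) auto
      then show False by (simp add: mu)
    qed
    then show "u \<in> walk_sphere G i v - (\<Union>k<i. walk_sphere G k v)"
      using long unfolding walk_sphere_def by (auto simp: not_le[symmetric])
  next
    assume u: "u \<in> walk_sphere G i v - (\<Union>k<i. walk_sphere G k v)"
    then obtain p where p: "awalk v p u" "length p = i" by (auto simp: walk_sphere_def)
    have "i \<le> length q" if "awalk v q u" for q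
    proof (rule ccontr)
      assume "\<not> i \<le> length q"
      then show False using that u unfolding walk_sphere_def by auto
    qed
    then have "ereal (real i) \<le> \<mu> (\<lambda>_. 1) v u"
      unfolding \<mu>_def cost by (intro INF_greatest) auto
    with min_cost_le_walk_cost[OF p(1), of "\<lambda>_. 1"] p(2)
    have "\<mu> (\<lambda>_. 1) v u = ereal (real i)" by (simp add: cost)
    then show "u \<in> dist_sphere G i v"
      using awalk_last_in_verts[OF p(1)] by (simp add: dist_sphere_def)
  }
qed

end

section \<open>Shift digraphs on restricted words\<close>

definition word_digraph ::
    "'a set \<Rightarrow> ('a \<Rightarrow> 'a \<Rightarrow> bool) \<Rightarrow> nat \<Rightarrow> ('a list, 'a list \<times> 'a list) pre_digraph" where
  "word_digraph A R D =
    \<lparr> verts = {v. set v \<subseteq> A \<and> length v = D \<and> successively R v},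
      arcs = {(v, tl v @ [x]) | v x. set v \<subseteq> A \<and> length v = D \<and> successively R v \<and>
                x \<in> A \<and> R (last v) x},
      tail = fst, head = snd \<rparr>"

lemma de_bruijn_eq_word_digraph: "de_bruijn A D = word_digraph A (\<lambda>_ _. True) D"
  by (simp add: de_bruijn_def word_digraph_def successively_conv_nth)

lemma kautz_eq_word_digraph: "kautz A D = word_digraph A (\<noteq>) D"
proof -
  have "length v = D \<Longrightarrow> (\<forall>k. Suc k < D \<longrightarrow> v ! k \<noteq> v ! Suc k) \<longleftrightarrow> successively (\<noteq>) v"
    for v :: "'a list" by (auto simp: successively_conv_nth)
  then show ?thesis
    unfolding kautz_def word_digraph_def
    by (auto intro!: arg_cong2[where f = "\<lambda>V E. \<lparr>verts = V, arcs = E, tail = fst, head = snd\<rparr>"])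
qed

text \<open>
  The common generalisation of De Bruijn and Kautz digraphs. The assumption on distinct letters
  matters for spheres of radius \<open>D\<close>, which carry no prefix: it makes every word whose first letter
  differs from the last letter of \<open>w\<close> reachable from \<open>w\<close> in \<open>D\<close> steps.
\<close>

locale regular_word_digraph =
  fixes A :: "'a set" and R :: "'a \<Rightarrow> 'a \<Rightarrow> bool" and D d :: nat
  assumes D_pos: "D \<ge> 1" and d_pos: "d \<ge> 1"
    and finite_alphabet: "finite A"
    and letter_degree: "x \<in> A \<Longrightarrow> card {y \<in> A. R x y} = d"
    and distinct_letters: "x \<in> A \<Longrightarrow> y \<in> A \<Longrightarrow> x \<noteq> y \<Longrightarrow> R x y"
begin

abbreviation "G \<equiv> word_digraph A R D"

lemma in_verts_iff: "v \<in> verts G \<longleftrightarrow> set v \<subseteq> A \<and> length v = D \<and> successively R v"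
  by (simp add: word_digraph_def)

lemma vertex_nonempty: "v \<in> verts G \<Longrightarrow> v \<noteq> []"
  using D_pos by (auto simp: in_verts_iff)

lemma shift_in_verts:
  assumes "v \<in> verts G" "x \<in> A" "R (last v) x"
  shows "tl v @ [x] \<in> verts G"
proof -
  obtain y t where "v = y # t" using vertex_nonempty[OF assms(1)] by (cases v) auto
  then show ?thesis using assms
    by (auto simp: in_verts_iff successively_append_iff successively_Cons split: if_splits)
qed

lemma arcs_from:
  assumes "v \<in> verts G"
  shows "{e \<in> arcs G. tail G e = v} = (\<lambda>x. (v, tl v @ [x])) ` {x \<in> A. R (last v) x}"
proof (rule set_eqI)
  fix e
  have "e \<in> arcs G \<longleftrightarrow> (\<exists>u x. e = (u, tl u @ [x]) \<and> u \<in> verts G \<and> x \<in> A \<and> R (last u) x)"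
    by (simp add: word_digraph_def)
  moreover have "tail G e = fst e" by (simp add: word_digraph_def)
  ultimately have "e \<in> {e \<in> arcs G. tail G e = v} \<longleftrightarrow>
      (\<exists>x. e = (v, tl v @ [x]) \<and> x \<in> A \<and> R (last v) x)"
    using assms by (metis (mono_tags, lifting) fst_conv mem_Collect_eq)
  then show "e \<in> {e \<in> arcs G. tail G e = v} \<longleftrightarrow>
      e \<in> (\<lambda>x. (v, tl v @ [x])) ` {x \<in> A. R (last v) x}"
    by (simp only: image_iff Bex_def mem_Collect_eq conj_commute conj_left_commute)
qed

sublocale wf_digraph G
proof
  fix e assume "e \<in> arcs G"
  then obtain v x where "e = (v, tl v @ [x])" "v \<in> verts G" "x \<in> A" "R (last v) x"
    by (auto simp: word_digraph_def)
  then show "tail G e \<in> verts G" "head G e \<in> verts G"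
    using shift_in_verts[of v x] by (simp_all add: word_digraph_def)
qed

lemma neighbours:
  assumes "v \<in> verts G"
  shows "walk_sphere G 1 v = (\<lambda>x. tl v @ [x]) ` {x \<in> A. R (last v) x}"
  unfolding walk_sphere_1 arcs_from[OF assms] by (simp add: image_image word_digraph_def)

text \<open>
  The words that can be appended, letter by letter, to a word with last letter \<open>x\<close>.
\<close>

definition continuations :: "'a \<Rightarrow> nat \<Rightarrow> 'a list set" where
  "continuations x k = {z. length z = k \<and> set z \<subseteq> A \<and> successively R (x # z)}"

lemma continuations_snoc:
  "continuations x (Suc k) =
    (\<Union>z\<in>continuations x k. (\<lambda>y. z @ [y]) ` {y \<in> A. R (last (x # z)) y})"
    (is "_ = ?U")
proof (rule set_eqI)
  fix t
  have last: "z @ [y] \<in> continuations x (Suc k) \<longleftrightarrow>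
      z \<in> continuations x k \<and> y \<in> A \<and> R (last (x # z)) y" for z y
    using successively_append_iff[of R "x # z" "[y]"] by (auto simp: continuations_def)
  show "t \<in> continuations x (Suc k) \<longleftrightarrow> t \<in> ?U"
  proof (cases t rule: rev_cases)
    case Nil
    then show ?thesis by (auto simp: continuations_def)
  next
    case (snoc z y)
    have "z @ [y] \<in> ?U \<longleftrightarrow> z \<in> continuations x k \<and> y \<in> A \<and> R (last (x # z)) y"
      by (auto simp only: UN_iff image_iff mem_Collect_eq append1_eq_conv)
    then show ?thesis using \<open>t = z @ [y]\<close> last[of z y] by simp
  qed
qed

lemma continuations_Cons:
  "continuations x (Suc k) = (\<lambda>(y, z). y # z) ` (SIGMA y:{y \<in> A. R x y}. continuations y k)"
proof (rule set_eqI)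
  fix t
  show "t \<in> continuations x (Suc k) \<longleftrightarrow>
      t \<in> (\<lambda>(y, z). y # z) ` (SIGMA y:{y \<in> A. R x y}. continuations y k)"
    by (cases t) (auto simp: continuations_def image_iff)
qed

lemma finite_continuations: "finite (continuations x k)"
  by (rule finite_subset[OF _ finite_lists_length_eq[OF finite_alphabet, of k]])
     (auto simp: continuations_def)

lemma card_continuations: "x \<in> A \<Longrightarrow> card (continuations x k) = d ^ k"
proof (induction k arbitrary: x)
  case 0
  have "continuations x 0 = {[]}" by (auto simp: continuations_def)
  then show ?case by simp
next
  case (Suc k)
  have "card (continuations x (Suc k)) = card (SIGMA y:{y \<in> A. R x y}. continuations y k)"
    unfolding continuations_Cons by (rule card_image) (auto simp: inj_on_def)
  also have "\<dots> = (\<Sum>y\<in>{y \<in> A. R x y}. card (continuations y k))"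
    by (rule card_SigmaI) (auto simp: finite_alphabet finite_continuations)
  also have "\<dots> = (\<Sum>y\<in>{y \<in> A. R x y}. d ^ k)"
    using Suc.IH by (intro sum.cong) auto
  finally show ?case using letter_degree[OF Suc.prems] by simp
qed

text \<open>
  Each step drops the first letter and appends an admissible one, and as long as \<open>k \<le> D\<close> only
  letters of the original word are dropped.
\<close>

lemma walk_sphere_words:
  assumes "v \<in> verts G"
  shows "k \<le> D \<Longrightarrow> walk_sphere G k v = (\<lambda>z. drop k v @ z) ` continuations (last v) k"
proof (induction k)
  case 0
  have "continuations (last v) 0 = {[]}" by (auto simp: continuations_def)
  then show ?case using assms by (simp add: walk_sphere_0)
next
  case (Suc k)
  have "length v = D" using assms by (simp add: in_verts_iff)
  with Suc.prems have ne: "drop k v \<noteq> []" by simp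
  have "walk_sphere G 1 (drop k v @ z) =
      (\<lambda>y. drop (Suc k) v @ z @ [y]) ` {y \<in> A. R (last (last v # z)) y}"
    if z: "z \<in> continuations (last v) k" for z
  proof -
    have "drop k v @ z \<in> verts G"
      using Suc z walk_sphere_subset_verts[of k v] by auto
    moreover have "tl (drop k v @ z) = drop (Suc k) v @ z"
      using ne by (simp add: drop_Suc tl_drop)
    moreover have "last (drop k v @ z) = last (last v # z)"
      using ne by (simp add: last_append)
    ultimately show ?thesis
      using neighbours[of "drop k v @ z"] by (simp only: append_assoc)
  qed
  note step = this
  have "walk_sphere G (Suc k) v =
      (\<Union>z\<in>continuations (last v) k. walk_sphere G 1 (drop k v @ z))"
    unfolding walk_sphere_Suc using Suc.IH Suc.prems by simp
  also have "\<dots> = (\<Union>z\<in>continuations (last v) k.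
      (\<lambda>y. drop (Suc k) v @ z @ [y]) ` {y \<in> A. R (last (last v # z)) y})"
    using step by (intro SUP_cong) simp_all
  also have "\<dots> = (\<lambda>z. drop (Suc k) v @ z) ` continuations (last v) (Suc k)"
    by (simp only: continuations_snoc image_UN image_image)
  finally show ?case .
qed

lemma card_walk_sphere:
  assumes "v \<in> verts G" "k \<le> D"
  shows "card (walk_sphere G k v) = d ^ k"
proof -
  have "last v \<in> A"
    using assms(1) last_in_set[OF vertex_nonempty[OF assms(1)]] by (auto simp: in_verts_iff)
  then show ?thesis
    unfolding walk_sphere_words[OF assms]
    by (subst card_image) (auto simp: inj_on_def card_continuations)
qed

lemma finite_walk_sphere: "v \<in> verts G \<Longrightarrow> k \<le> D \<Longrightarrow> finite (walk_sphere G k v)"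
  by (simp add: walk_sphere_words finite_continuations)

lemma walk_sphere_nonempty: "v \<in> verts G \<Longrightarrow> k \<le> D \<Longrightarrow> walk_sphere G k v \<noteq> {}"
  using card_walk_sphere[of v k] d_pos by auto

text \<open>
  For \<open>k < D\<close> the last letter of \<open>v\<close> survives in \<open>u\<close>, so that admissibility of the first new
  letter is part of \<open>u\<close> being a vertex; for \<open>k = D\<close> it has to be demanded separately.
\<close>

lemma in_walk_sphere_iff:
  assumes v: "v \<in> verts G" and k: "k \<le> D"
  shows "u \<in> walk_sphere G k v \<longleftrightarrow>
    u \<in> verts G \<and> take (D - k) u = drop k v \<and> (k = D \<longrightarrow> R (last v) (hd u))"
    (is "?L \<longleftrightarrow> ?R")
proof
  have len: "length v = D" using v by (simp add: in_verts_iff)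
  {
    assume L: ?L
    then obtain z where z: "u = drop k v @ z" "z \<in> continuations (last v) k"
      using walk_sphere_words[OF v k] by auto
    have "u \<in> verts G" using L walk_sphere_subset_verts by blast
    moreover have "take (D - k) u = drop k v" using z len by simp
    moreover have "R (last v) (hd u)" if "k = D"
      using z len that D_pos by (auto simp: continuations_def successively_Cons)
    ultimately show ?R by blast
  next
    assume R: ?R
    define z where "z = drop (D - k) u"
    have u: "u = drop k v @ z" using R append_take_drop_id[of "D - k" u] by (simp add: z_def)
    have "successively R (last v # z)"
    proof (cases "k = D")
      case True
      then show ?thesis using R by (auto simp: z_def in_verts_iff successively_Cons)
    next
      case False
      then have "drop k v \<noteq> []" "last (drop k v) = last v" using k len by simp_all
      moreover have "successively R (drop k v @ z)" using R u by (simp add: in_verts_iff)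
      ultimately show ?thesis by (auto simp: successively_append_iff successively_Cons)
    qed
    moreover have "length z = k" "set z \<subseteq> A"
      using R k set_drop_subset[of "D - k" u] by (auto simp: z_def in_verts_iff)
    ultimately have "z \<in> continuations (last v) k" by (simp add: continuations_def)
    then show ?L using u walk_sphere_words[OF v k] by blast
  }
qed

text \<open>
  All words of \<open>S\<^sub>k(v)\<close> agree on their first \<open>D - k \<ge> 1\<close> letters, and membership in \<open>S\<^sub>m(w)\<close> is
  decided by the first \<open>D - m\<close> letters, or by the first letter when \<open>m = D\<close>. Hence one common
  vertex is enough for inclusion. The radius \<open>k = D\<close> has to be excluded: in a Kautz digraph two
  spheres of radius \<open>D\<close> around different centres can meet without being nested.
\<close>

lemma walk_sphere_laminar:
  assumes "v \<in> verts G" "w \<in> verts G" "k \<le> m" "k < D" "m \<le> D"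
    and u: "u \<in> walk_sphere G k v" "u \<in> walk_sphere G m w"
  shows "walk_sphere G k v \<subseteq> walk_sphere G m w"
proof
  fix x assume x: "x \<in> walk_sphere G k v"
  have "take (D - k) x = take (D - k) u"
    using x u(1) assms(1,4) by (simp add: in_walk_sphere_iff)
  then have agree: "take n x = take n u" if "n \<le> D - k" for n
    using that by (metis min.absorb1 take_take)
  have "take (D - m) x = take (D - m) u" using agree assms(3) by simp
  moreover have "hd x = hd u"
    using agree[of 1] assms(4) by (metis One_nat_def Suc_leI hd_take less_numeral_extra(1) zero_less_diff)
  ultimately show "x \<in> walk_sphere G m w"
    using x u assms by (simp add: in_walk_sphere_iff)
qed

end

section \<open>Maximal contained spheres\<close>

context regular_word_digraph
begin

lemma max_walk_sphere_nonempty_iff: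
  assumes "v \<in> verts G" "k \<le> D"
  shows "max_walk_sphere G k i v \<noteq> {} \<longleftrightarrow>
    walk_sphere G k v \<subseteq> walk_sphere G i v \<and>
    (\<forall>j. k < j \<and> j < i \<and> walk_sphere G j v \<subseteq> walk_sphere G i v
      \<longrightarrow> \<not> walk_sphere G k v \<subseteq> walk_sphere G j v)"
  using walk_sphere_nonempty[OF assms] by (simp add: max_walk_sphere_def)

lemma max_walk_spheres_disjoint:
  assumes v: "v \<in> verts G" and kj: "k < j" "j < i" and i: "i \<le> D"
    and "max_walk_sphere G k i v \<noteq> {}" "max_walk_sphere G j i v \<noteq> {}"
  shows "walk_sphere G k v \<inter> walk_sphere G j v = {}"
proof (rule ccontr)
  assume "walk_sphere G k v \<inter> walk_sphere G j v \<noteq> {}"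
  then have "walk_sphere G k v \<subseteq> walk_sphere G j v"
    using walk_sphere_laminar[of v v k j] v kj i by auto
  then show False using assms by (auto simp: max_walk_sphere_nonempty_iff)
qed

text \<open>
  The largest radius below \<open>i\<close> whose sphere still contains \<open>u\<close> belongs to a maximal sphere, since
  a larger sphere around it would contain \<open>u\<close> as well. Together with disjointness, this makes the
  maximal spheres a partition of the part of \<open>S\<^sub>i(v)\<close> covered by smaller spheres.
\<close>

lemma in_max_walk_sphere:
  assumes v: "v \<in> verts G" and i: "i \<le> D"
    and u: "u \<in> walk_sphere G i v" "u \<in> walk_sphere G k v" "k < i"
  obtains m where "m < i" "u \<in> walk_sphere G m v" "max_walk_sphere G m i v \<noteq> {}"
proof -
  define m where "m = Max {j. j < i \<and> u \<in> walk_sphere G j v}"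
  have fin: "finite {j. j < i \<and> u \<in> walk_sphere G j v}" by simp
  then have m: "m < i" "u \<in> walk_sphere G m v"
    using Max_in[OF fin] u unfolding m_def by blast+
  have last: "u \<notin> walk_sphere G j v" if "m < j" "j < i" for j
  proof
    assume "u \<in> walk_sphere G j v"
    then have "j \<le> m" unfolding m_def using that by (intro Max_ge fin) simp
    with that show False by simp
  qed
  have "walk_sphere G m v \<subseteq> walk_sphere G i v"
    using walk_sphere_laminar[of v v m i u] v m i u by simp
  then have "max_walk_sphere G m i v \<noteq> {}"
    using last m v i by (subst max_walk_sphere_nonempty_iff) auto
  with m that show ?thesis by blast
qed

end

section \<open>The distance sphere seen from an out-neighbour\<close>

context regular_word_digraph
begin

text \<open>
  The prefix that defines \<open>S\<^sub>i\<^sub>-\<^sub>1(w)\<close> is the one that defines \<open>S\<^sub>i(v)\<close> followed by the last letter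
  of \<open>w\<close>.
\<close>

lemma neighbour_sphere_iff:
  assumes v: "v \<in> verts G" and w: "w \<in> walk_sphere G 1 v" and i: "1 \<le> i" "i \<le> D"
    and u: "u \<in> walk_sphere G i v"
  shows "u \<in> walk_sphere G (i - 1) w \<longleftrightarrow> u ! (D - i) = w ! (D - 1)"
proof -
  obtain x where x: "w = tl v @ [x]" using w neighbours[OF v] by auto
  have wV: "w \<in> verts G" using w walk_sphere_subset_verts by blast
  have len: "length v = D" "length u = D"
    using v subsetD[OF walk_sphere_subset_verts u] by (simp_all add: in_verts_iff)
  have uV: "u \<in> verts G" "take (D - i) u = drop i v"
    using u v i by (simp_all add: in_walk_sphere_iff)
  have "drop (i - 1) w = drop i v @ [x]"
    using i len x by (simp add: drop_Suc[symmetric])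
  moreover have "take (D - (i - 1)) u = drop i v @ [u ! (D - i)]"
    using take_Suc_conv_app_nth[of "D - i" u] uV i len by (simp add: Suc_diff_le)
  moreover have "w ! (D - 1) = x" using x len by (simp add: nth_append)
  moreover have "i - 1 \<noteq> D" "i - 1 \<le> D" using i by simp_all
  ultimately show ?thesis using uV wV by (simp add: in_walk_sphere_iff)
qed

text \<open>
  A walk from \<open>w\<close> extends by the arc from \<open>v\<close> to \<open>w\<close>. So a vertex of \<open>S\<^sub>i\<^sub>-\<^sub>1(w)\<close> is in \<open>S\<^sub>i(v)\<close>, and a
  walk from \<open>w\<close> shorter than \<open>i - 1\<close> would give one from \<open>v\<close> shorter than \<open>i\<close>.
\<close>

lemma dist_sphere_inter_neighbour:
  assumes w: "w \<in> walk_sphere G 1 v" and i: "1 \<le> i"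
  shows "dist_sphere G i v \<inter> dist_sphere G (i - 1) w =
    walk_sphere G (i - 1) w - (\<Union>k<i. walk_sphere G k v)"
proof -
  have "u \<in> walk_sphere G (Suc k) v" if "u \<in> walk_sphere G k w" for u k
    using walk_sphere_trans[OF w that] by simp
  note step = this
  have "u \<in> walk_sphere G i v" if "u \<in> walk_sphere G (i - 1) w" for u
    using step[OF that] i by simp
  moreover have "u \<in> (\<Union>k<i. walk_sphere G k v)"
    if "m < i - 1" "u \<in> walk_sphere G m w" for u m
    using step[OF that(2)] that(1) by (intro UN_I[of "Suc m"]) auto
  ultimately show ?thesis unfolding dist_sphere_eq by blast
qed

text \<open>
  The spheres to be removed from \<open>S\<^sub>i\<^sub>-\<^sub>1(w)\<close> are those with index in \<open>M\<close>: by laminarity each maximal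
  sphere around \<open>v\<close> with radius below \<open>i - 1\<close> lies inside \<open>S\<^sub>i\<^sub>-\<^sub>1(w)\<close> or misses it, and its letter
  at position \<open>D - i\<close> tells which. The sphere \<open>S\<^sub>i\<^sub>-\<^sub>1(v)\<close> cannot meet \<open>S\<^sub>i\<^sub>-\<^sub>1(w)\<close>: it would then
  contain all of it, and the intersection to be counted would be empty.
\<close>

lemma card_dist_sphere_inter_neighbour:
  assumes v: "v \<in> verts G" and w: "w \<in> walk_sphere G 1 v" and i: "1 \<le> i" "i \<le> D"
    and ne: "dist_sphere G i v \<inter> dist_sphere G (i - 1) w \<noteq> {}"
  defines "M \<equiv> {k. k < i - 1 \<and> max_walk_sphere G k i v \<noteq> {} \<and> v ! (D - i + k) = w ! (D - 1)}"
  shows "int (card (dist_sphere G i v \<inter> dist_sphere G (i - 1) w)) =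
    int d ^ (i - 1) - (\<Sum>k\<in>M. int d ^ k)"
proof -
  let ?C = "walk_sphere G (i - 1) w"
  have wV: "w \<in> verts G" using w walk_sphere_subset_verts by blast
  have letter: "u ! (D - i) = v ! (D - i + k)" if "u \<in> walk_sphere G k v" "k < i" for u k
  proof -
    have "take (D - k) u = drop k v" using that v i by (simp add: in_walk_sphere_iff)
    moreover have "D - i < D - k" using that i by simp
    ultimately have "u ! (D - i) = drop k v ! (D - i)" by (metis nth_take)
    moreover have "length v = D" using v by (simp add: in_verts_iff)
    ultimately show ?thesis using that i by (simp add: add.commute)
  qed
  have "?C \<inter> (\<Union>k<i. walk_sphere G k v) = (\<Union>k\<in>M. walk_sphere G k v)"
  proof (intro equalityI subsetI)
    fix u assume "u \<in> ?C \<inter> (\<Union>k<i. walk_sphere G k v)"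
    then obtain k where u: "u \<in> ?C" "k < i" "u \<in> walk_sphere G k v" by auto
    have "u \<in> walk_sphere G i v" using walk_sphere_trans[OF w u(1)] i by simp
    then obtain m where m: "m < i" "u \<in> walk_sphere G m v" "max_walk_sphere G m i v \<noteq> {}"
      using in_max_walk_sphere[OF v i(2) _ u(3,2)] by blast
    have "m \<noteq> i - 1"
    proof
      assume "m = i - 1"
      then have "?C \<subseteq> walk_sphere G (i - 1) v"
        using walk_sphere_laminar[of w v "i - 1" "i - 1" u] v wV u m i by simp
      then show False using ne i unfolding dist_sphere_inter_neighbour[OF w i(1)] by force
    qed
    moreover have "v ! (D - i + m) = w ! (D - 1)"
      using neighbour_sphere_iff[OF v w i \<open>u \<in> walk_sphere G i v\<close>] u(1) letter[OF m(2,1)] by simp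
    ultimately show "u \<in> (\<Union>k\<in>M. walk_sphere G k v)"
      using m by (intro UN_I[of m]) (auto simp: M_def)
  next
    fix u assume "u \<in> (\<Union>k\<in>M. walk_sphere G k v)"
    then obtain k where k: "k \<in> M" "u \<in> walk_sphere G k v" by blast
    then have "k < i" "k \<le> D" "max_walk_sphere G k i v \<noteq> {}" using i by (auto simp: M_def)
    then have "u \<in> walk_sphere G i v"
      using k(2) max_walk_sphere_nonempty_iff[OF v] by blast
    then have "u \<in> ?C"
      using neighbour_sphere_iff[OF v w i] letter[OF k(2) \<open>k < i\<close>] k(1)
      by (simp add: M_def)
    then show "u \<in> ?C \<inter> (\<Union>k<i. walk_sphere G k v)" using k \<open>k < i\<close> by blast
  qed
  moreover have "card (\<Union>k\<in>M. walk_sphere G k v) = (\<Sum>k\<in>M. card (walk_sphere G k v))"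
  proof (rule card_UN_disjoint)
    show "finite M" by (simp add: M_def)
    show "\<forall>k\<in>M. finite (walk_sphere G k v)"
      using v i by (auto simp: M_def finite_walk_sphere)
    show "\<forall>k\<in>M. \<forall>j\<in>M. k \<noteq> j \<longrightarrow> walk_sphere G k v \<inter> walk_sphere G j v = {}"
    proof (intro ballI impI)
      fix k j assume kj: "k \<in> M" "j \<in> M" "k \<noteq> j"
      then have "k < i" "j < i" by (auto simp: M_def)
      from kj consider "k < j" | "j < k" by linarith
      then show "walk_sphere G k v \<inter> walk_sphere G j v = {}"
        using max_walk_spheres_disjoint[OF v _ _ i(2), of k j]
          max_walk_spheres_disjoint[OF v _ _ i(2), of j k] kj \<open>k < i\<close> \<open>j < i\<close>
        by cases (auto simp: M_def)
    qed
  qed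
  moreover have "(\<Sum>k\<in>M. card (walk_sphere G k v)) = (\<Sum>k\<in>M. d ^ k)"
    using v i by (intro sum.cong) (auto simp: M_def card_walk_sphere)
  moreover have C: "finite ?C" "card ?C = d ^ (i - 1)"
    using wV i by (simp_all add: finite_walk_sphere card_walk_sphere)
  moreover have "int (card (X - Y)) = int (card X) - int (card (X \<inter> Y))"
    if "finite X" for X Y :: "'a list set"
    using that card_Int_Diff[of X Y] by simp
  ultimately show ?thesis
    unfolding dist_sphere_inter_neighbour[OF w i(1)] by simp
qed

text \<open>
  Vertices of the left-hand side all lie in the same walk spheres around \<open>w\<close> of radius at most
  \<open>D\<close>, hence have the same distance from \<open>w\<close> as soon as one of them has distance \<open>j \<le> D\<close>.
\<close>

lemma dist_sphere_diff_neighbour: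
  assumes v: "v \<in> verts G" and w: "w \<in> walk_sphere G 1 v" and i: "1 \<le> i" "i \<le> D"
    and j: "i \<le> j" "j \<le> D" and ne: "dist_sphere G i v \<inter> dist_sphere G j w \<noteq> {}"
  shows "dist_sphere G i v - dist_sphere G (i - 1) w = dist_sphere G i v \<inter> dist_sphere G j w"
proof -
  have wV: "w \<in> verts G" using w walk_sphere_subset_verts by blast
  let ?B = "dist_sphere G i v - dist_sphere G (i - 1) w"
  have far: "u \<notin> walk_sphere G m w" if u: "u \<in> ?B" and m: "m < i" for u m
  proof
    assume um: "u \<in> walk_sphere G m w"
    have "u \<in> walk_sphere G (Suc m) v" using walk_sphere_trans[OF w um] by simp
    then have "m = i - 1" using u m unfolding dist_sphere_eq[of i v] by force
    then have "u \<in> dist_sphere G i v \<inter> dist_sphere G (i - 1) w"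
      using dist_sphere_inter_neighbour[OF w i(1)] u um by (auto simp: dist_sphere_eq[of i v])
    with u show False by blast
  qed
  have same: "u' \<in> walk_sphere G m w"
    if u: "u \<in> ?B" "u' \<in> ?B" and m: "m \<le> D" and um: "u \<in> walk_sphere G m w" for u u' m
  proof (cases "i = D")
    case True
    \<comment> \<open>Laminarity fails for radius \<open>D\<close>, but here only \<open>m = D\<close> is left, and \<open>u'\<close> does not start
      with the last letter of \<open>w\<close>, so it is reached from \<open>w\<close> in \<open>D\<close> steps.\<close>
    have "m = D" using far[OF u(1), of m] um m True by (cases "m < i") auto
    have u': "u' \<in> walk_sphere G i v" "u' \<in> verts G"
      using u walk_sphere_subset_verts by (auto simp: dist_sphere_eq[of i v])
    have "u' ! 0 \<noteq> w ! (D - 1)"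
      using neighbour_sphere_iff[OF v w i u'(1)] far[OF u(2), of "i - 1"] i True by simp
    moreover have "u' ! 0 = hd u'" "w ! (D - 1) = last w"
      using vertex_nonempty u'(2) wV
      by (auto simp: hd_conv_nth last_conv_nth in_verts_iff)
    moreover have "hd u' \<in> A" "last w \<in> A"
      using hd_in_set[OF vertex_nonempty[OF u'(2)]] last_in_set[OF vertex_nonempty[OF wV]] u'(2) wV
      by (auto simp: in_verts_iff)
    ultimately have "R (last w) (hd u')" 
      using distinct_letters[of "last w" "hd u'"] by simp
    then show ?thesis using \<open>m = D\<close> u' wV by (simp add: in_walk_sphere_iff in_verts_iff)
  next
    case False
    moreover have "i \<le> m" using far[OF u(1), of m] um by (cases "m < i") auto
    ultimately show ?thesis
      using walk_sphere_laminar[of v w i m u] v wV i m u um by (auto simp: dist_sphere_eq[of i v])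
  qed
  obtain u0 where u0: "u0 \<in> dist_sphere G i v" "u0 \<in> dist_sphere G j w" using ne by blast
  have notnear: "u \<notin> dist_sphere G (i - 1) w" if "u \<in> dist_sphere G j w" for u
  proof -
    have "i - 1 < j" using i j by simp
    then show ?thesis using that by (auto simp: dist_sphere_eq)
  qed
  have u0B: "u0 \<in> ?B" using u0 notnear by blast
  have "u \<in> dist_sphere G j w" if "u \<in> ?B" for u
  proof -
    have "u0 \<in> walk_sphere G m w \<longleftrightarrow> u \<in> walk_sphere G m w" if "m \<le> D" for m
      using same[OF u0B \<open>u \<in> ?B\<close> that] same[OF \<open>u \<in> ?B\<close> u0B that] by blast
    then show ?thesis using u0(2) j by (auto simp: dist_sphere_eq[of j w])
  qed
  then show ?thesis using notnear by blast
qed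

lemma card_dist_sphere_split:
  assumes v: "v \<in> verts G" and w: "w \<in> walk_sphere G 1 v" and i: "1 \<le> i" "i \<le> D"
    and j: "i \<le> j" "j \<le> D" and far: "dist_sphere G i v \<inter> dist_sphere G j w \<noteq> {}"
  shows "card (dist_sphere G i v) =
    card (dist_sphere G i v \<inter> dist_sphere G (i - 1) w) +
    card (dist_sphere G i v \<inter> dist_sphere G j w)"
proof -
  have "finite (dist_sphere G i v)"
    using v i by (auto simp: dist_sphere_eq finite_walk_sphere)
  then show ?thesis
    unfolding dist_sphere_diff_neighbour[OF assms, symmetric] by (rule card_Int_Diff)
qed

lemma card_dist_sphere_parts:
  fixes a b :: "nat \<Rightarrow> int"
  assumes v: "v \<in> verts G" and w: "w \<in> walk_sphere G 1 v" and i: "1 \<le> i" "i \<le> D"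
    and near: "dist_sphere G i v \<inter> dist_sphere G (i - 1) w \<noteq> {}"
    and j: "i \<le> j" "j \<le> D" and far: "dist_sphere G i v \<inter> dist_sphere G j w \<noteq> {}"
    and a: "\<forall>k<i. a k \<in> {0, 1} \<and> (a k = 1 \<longleftrightarrow> max_walk_sphere G k i v \<noteq> {})"
    and S: "int (card (dist_sphere G i v)) = int d ^ i - (\<Sum>k<i. a k * int d ^ k)"
    and b: "\<forall>k<i - 1. b k \<in> {0, 1} \<and>
      (b k = 1 \<longleftrightarrow> a k = 1 \<and> v ! (D - i + k) = w ! (D - 1))"
  shows "int (card (dist_sphere G i v \<inter> dist_sphere G (i - 1) w)) =
      int d ^ (i - 1) - (\<Sum>k<i - 1. b k * int d ^ k)" (is ?near)
    and "int (card (dist_sphere G i v \<inter> dist_sphere G j w)) =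
      int d ^ i - (a (i - 1) + 1) * int d ^ (i - 1)
        - (\<Sum>k<i - 1. (a k - b k) * int d ^ k)" (is ?far)
proof -
  have "(\<Sum>k | k < i - 1 \<and> max_walk_sphere G k i v \<noteq> {} \<and>
          v ! (D - i + k) = w ! (D - 1). int d ^ k) = (\<Sum>k<i - 1. b k * int d ^ k)"
    using a b by (intro sum.mono_neutral_cong_left) auto
  then show near_card: ?near
    using card_dist_sphere_inter_neighbour[OF v w i near] by simp
  have "(\<Sum>k<i. a k * int d ^ k) =
      (\<Sum>k<i - 1. a k * int d ^ k) + a (i - 1) * int d ^ (i - 1)"
    using i sum.lessThan_Suc[of "\<lambda>k. a k * int d ^ k" "i - 1"] by simp
  then show ?far
    using near_card S card_dist_sphere_split[OF v w i j far]
    by (simp add: algebra_simps sum_subtractf)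
qed

end

section \<open>De Bruijn and Kautz digraphs\<close>

lemma regular_word_digraph_de_bruijn:
  assumes "D \<ge> 1" "card A \<ge> 1" "finite A"
  shows "regular_word_digraph A (\<lambda>_ _. True) D (card A)"
  using assms by unfold_locales auto

lemma regular_word_digraph_kautz:
  assumes "D \<ge> 1" "d \<ge> 1" "finite A" "card A = d + 1"
  shows "regular_word_digraph A (\<noteq>) D d"
proof
  fix x assume "x \<in> A"
  moreover have "{y \<in> A. x \<noteq> y} = A - {x}" by auto
  ultimately show "card {y \<in> A. x \<noteq> y} = d" using assms by simp
qed (use assms in auto)

theorem theorem1:
  fixes A :: "'a set" and d D i j0 :: nat
    and G :: "('a list, 'a list \<times> 'a list) pre_digraph"
    and v w :: "'a list"
  assumes "d \<ge> 2" and "D \<ge> 1" and "finite A"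
    and "card A = d \<and> G = de_bruijn A D \<or> card A = d + 1 \<and> G = kautz A D"
    and "v \<in> verts G" and "w \<in> walk_sphere G 1 v"
    and "1 \<le> i" and "i \<le> D"
    and "dist_sphere G i v \<inter> dist_sphere G (i - 1) w \<noteq> {}"
    and "i \<le> j0" and "j0 \<le> D"
    and "dist_sphere G i v \<inter> dist_sphere G j0 w \<noteq> {}"
  shows "dist_sphere G i v =
           (dist_sphere G i v \<inter> dist_sphere G (i - 1) w) \<union>
           (dist_sphere G i v \<inter> dist_sphere G j0 w)
       \<and> card (dist_sphere G i v) =
           card (dist_sphere G i v \<inter> dist_sphere G (i - 1) w) +
           card (dist_sphere G i v \<inter> dist_sphere G j0 w)
       \<and> (\<forall>a b :: nat \<Rightarrow> int.
            (\<forall>k<i. a k \<in> {0, 1} \<and> (a k = 1 \<longleftrightarrow> max_walk_sphere G k i v \<noteq> {})) \<and>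
            int (card (dist_sphere G i v)) = int d ^ i - (\<Sum>k<i. a k * int d ^ k) \<and>
            (\<forall>k<i - 1. b k \<in> {0, 1} \<and>
               (b k = 1 \<longleftrightarrow> a k = 1 \<and> v ! (D - i + k) = w ! (D - 1)))
            \<longrightarrow>
            int (card (dist_sphere G i v \<inter> dist_sphere G (i - 1) w)) =
              int d ^ (i - 1) - (\<Sum>k<i - 1. b k * int d ^ k) \<and>
            int (card (dist_sphere G i v \<inter> dist_sphere G j0 w)) =
              int d ^ i - (a (i - 1) + 1) * int d ^ (i - 1)
                - (\<Sum>k<i - 1. (a k - b k) * int d ^ k))"
proof -
  have "\<exists>R. G = word_digraph A R D \<and> regular_word_digraph A R D d"
    using assms(4)
  proof
    assume A: "card A = d \<and> G = de_bruijn A D"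
    then have "regular_word_digraph A (\<lambda>_ _. True) D d"
      using regular_word_digraph_de_bruijn[of D A] assms(1-3) by simp
    with A show ?thesis unfolding de_bruijn_eq_word_digraph by blast
  next
    assume A: "card A = d + 1 \<and> G = kautz A D"
    then have "regular_word_digraph A (\<noteq>) D d"
      using regular_word_digraph_kautz[of D d A] assms(1-3) by simp
    with A show ?thesis unfolding kautz_eq_word_digraph by blast
  qed
  then obtain R where G: "G = word_digraph A R D" and "regular_word_digraph A R D d" by blast
  note R = this(2)
  note hyps = assms(5-8)[unfolded G] and near = assms(9)[unfolded G]
    and far = assms(10-12)[unfolded G]
  show ?thesis
    unfolding G
  proof (intro conjI allI impI; (elim conjE)?)
    show "dist_sphere (word_digraph A R D) i v =
        dist_sphere (word_digraph A R D) i v \<inter> dist_sphere (word_digraph A R D) (i - 1) w \<union>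
        dist_sphere (word_digraph A R D) i v \<inter> dist_sphere (word_digraph A R D) j0 w"
      unfolding regular_word_digraph.dist_sphere_diff_neighbour[OF R hyps far, symmetric]
      by (rule Int_Diff_Un[symmetric])
  qed (rule regular_word_digraph.card_dist_sphere_split[OF R hyps far]
      regular_word_digraph.card_dist_sphere_parts[OF R hyps near far]; assumption)+
qed

end
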